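(* Let $k$ be a positive integer and let $\mathcal{C}$ be any one of the following five classes of independence systems: $k$-matroid intersection systems, $k$-matchoids, $k$-circuit bounded systems, $k$-growth systems, $k$-extendible systems. If $\mathcal{F}=(S,\mathcal{I})$ belongs to $\mathcal{C}$, then so do all parallel extensions, restrictions and contractions of $\mathcal{F}$.
   Context: An independence system $(S,\mathcal{I})$ is a finite set $S$ with a nonempty downward-closed family $\mathcal{I}\subseteq2^S$ of independent sets. Circuits are the minimal non-independent sets; a loop is a circuit of size 1. A basis of $X\subseteq S$ is a maximal independent subset of $X$. Parallel extension of $\mathcal{F}$ along a non-loop element $s\in S$: ground set $S_{\circ s}=(S\setminus\{s\})\cup\{s_1,s_2\}$ with new elements $s_1,s_2$; for $X\subseteq S_{\circ s}$ let $\pi_s(X)=X$ if $X\cap\{s_1,s_2\}=\emptyset$ and $\pi_s(X)=(X\setminus\{s_1,s_2\})\cup\{s\}$ otherwise; the independent sets are the $X\subseteq S_{\circ s}$ with $|X\cap\{s_1,s_2\}|\le1$ and $\pi_s(X)\in\mathcal{I}$. Restriction to $Y\subseteq S$: $(Y,\{X\subseteq Y:X\in\mathcal{I}\})$. Contraction of $I\in\mathcal{I}$: $(S\setminus I,\{X\subseteq S\setminus I:X\cup I\in\mathcal{I}\})$. $k$-matroid intersection: $\mathcal{I}=\bigcap_{i=1}^k\mathcal{I}_i$ for some matroids $(S,\mathcal{I}_i)$, $i\in[k]$. $k$-matchoid: there are matroids $(S_i,\mathcal{I}_i)$, $i\in[N]$, with $S=\bigcup_iS_i$, each $e\in S$ in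 at most $k$ of the $S_i$, and $\mathcal{I}=\{F\subseteq S:F\cap S_i\in\mathcal{I}_i\ \forall i\}$. $k$-circuit bounded: for every $I\in\mathcal{I}$ and $e\in S\setminus I$, $I\cup\{e\}$ contains at most $k$ distinct circuits. $k$-growth: for all $X\subseteq S$ and $I\in\mathcal{I}$ there is a partition $(Q,Z)$ of $I\setminus X$ with $|Z|\le k|X\setminus I|$ such that $P\cup Q\in\mathcal{I}$ for every basis $P$ of $X$. $k$-extendible: for every $A\subseteq B\in\mathcal{I}$ and $e\in S\setminus B$ with $A\cup\{e\}\in\mathcal{I}$, there is $Z\subseteq B\setminus A$ with $|Z|\le k$ and $(B\cup\{e\})\setminus Z\in\mathcal{I}$. *)

theory Defs
  imports Main
begin

text \<open>A set system is a pair \<open>(S, \<I>)\<close> of a ground set and a family of sets, called independent.\<close>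

type_synonym 'a set_system = "'a set \<times> 'a set set"

abbreviation ground :: "'a set_system \<Rightarrow> 'a set" where
  "ground \<equiv> fst"

abbreviation indep :: "'a set_system \<Rightarrow> 'a set set" where
  "indep \<equiv> snd"

definition independence_system :: "'a set_system \<Rightarrow> bool" where
  "independence_system F \<longleftrightarrow>
     finite (ground F) \<and> indep F \<subseteq> Pow (ground F) \<and> indep F \<noteq> {} \<and>
     (\<forall>X Y. X \<in> indep F \<and> Y \<subseteq> X \<longrightarrow> Y \<in> indep F)"

definition circuit :: "'a set_system \<Rightarrow> 'a set \<Rightarrow> bool" where
  "circuit F C \<longleftrightarrow> C \<subseteq> ground F \<and> C \<notin> indep F \<and> (\<forall>D. D \<subset> C \<longrightarrow> D \<in> indep F)"

definition loop :: "'a set_system \<Rightarrow> 'a \<Rightarrow> bool" where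
  "loop F e \<longleftrightarrow> circuit F {e}"

definition basis_of :: "'a set_system \<Rightarrow> 'a set \<Rightarrow> 'a set \<Rightarrow> bool" where
  "basis_of F X P \<longleftrightarrow>
     P \<subseteq> X \<and> P \<in> indep F \<and> (\<forall>P'. P \<subseteq> P' \<and> P' \<subseteq> X \<and> P' \<in> indep F \<longrightarrow> P' = P)"

definition matroid :: "'a set_system \<Rightarrow> bool" where
  "matroid M \<longleftrightarrow> independence_system M \<and>
     (\<forall>X \<in> indep M. \<forall>Y \<in> indep M. card X < card Y \<longrightarrow> (\<exists>y \<in> Y - X. insert y X \<in> indep M))"


definition parallel_proj :: "'a \<Rightarrow> 'a \<Rightarrow> 'a \<Rightarrow> 'a set \<Rightarrow> 'a set" where
  "parallel_proj s s1 s2 X =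
     (if X \<inter> {s1, s2} = {} then X else (X - {s1, s2}) \<union> {s})"

text \<open>Meant for a non-loop \<open>s \<in> ground F\<close> and distinct \<open>s1\<close>, \<open>s2\<close> outside \<open>ground F\<close>;
  these conditions are imposed where the operation is used.\<close>

definition parallel_extension :: "'a set_system \<Rightarrow> 'a \<Rightarrow> 'a \<Rightarrow> 'a \<Rightarrow> 'a set_system" where
  "parallel_extension F s s1 s2 =
     (let S' = (ground F - {s}) \<union> {s1, s2}
      in (S', {X. X \<subseteq> S' \<and> card (X \<inter> {s1, s2}) \<le> 1 \<and> parallel_proj s s1 s2 X \<in> indep F}))"

definition restriction :: "'a set_system \<Rightarrow> 'a set \<Rightarrow> 'a set_system" where
  "restriction F Y = (Y, {X. X \<subseteq> Y \<and> X \<in> indep F})"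

definition contraction :: "'a set_system \<Rightarrow> 'a set \<Rightarrow> 'a set_system" where
  "contraction F I = (ground F - I, {X. X \<subseteq> ground F - I \<and> X \<union> I \<in> indep F})"


definition k_matroid_intersection :: "nat \<Rightarrow> 'a set_system \<Rightarrow> bool" where
  "k_matroid_intersection k F \<longleftrightarrow> independence_system F \<and>
     (\<exists>\<I> :: nat \<Rightarrow> 'a set set.
        (\<forall>i \<in> {1..k}. matroid (ground F, \<I> i)) \<and> indep F = (\<Inter>i \<in> {1..k}. \<I> i))"

definition k_matchoid :: "nat \<Rightarrow> 'a set_system \<Rightarrow> bool" where
  "k_matchoid k F \<longleftrightarrow> independence_system F \<and>
     (\<exists>(N :: nat) (S :: nat \<Rightarrow> 'a set) (\<I> :: nat \<Rightarrow> 'a set set).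
        (\<forall>i \<in> {1..N}. matroid (S i, \<I> i)) \<and>
        ground F = (\<Union>i \<in> {1..N}. S i) \<and>
        (\<forall>e \<in> ground F. card {i \<in> {1..N}. e \<in> S i} \<le> k) \<and>
        indep F = {X. X \<subseteq> ground F \<and> (\<forall>i \<in> {1..N}. X \<inter> S i \<in> \<I> i)})"

definition k_circuit_bounded :: "nat \<Rightarrow> 'a set_system \<Rightarrow> bool" where
  "k_circuit_bounded k F \<longleftrightarrow> independence_system F \<and>
     (\<forall>I \<in> indep F. \<forall>e \<in> ground F - I. card {C. circuit F C \<and> C \<subseteq> I \<union> {e}} \<le> k)"

text \<open>The parts \<open>Q\<close> and \<open>Z\<close> of the partition may be empty.\<close>

definition k_growth :: "nat \<Rightarrow> 'a set_system \<Rightarrow> bool" where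
  "k_growth k F \<longleftrightarrow> independence_system F \<and>
     (\<forall>X I. X \<subseteq> ground F \<and> I \<in> indep F \<longrightarrow>
        (\<exists>Q Z. Q \<union> Z = I - X \<and> Q \<inter> Z = {} \<and> card Z \<le> k * card (X - I) \<and>
           (\<forall>P. basis_of F X P \<longrightarrow> P \<union> Q \<in> indep F)))"

definition k_extendible :: "nat \<Rightarrow> 'a set_system \<Rightarrow> bool" where
  "k_extendible k F \<longleftrightarrow> independence_system F \<and>
     (\<forall>A B e. A \<subseteq> B \<and> B \<in> indep F \<and> e \<in> ground F - B \<and> A \<union> {e} \<in> indep F \<longrightarrow>
        (\<exists>Z. Z \<subseteq> B - A \<and> card Z \<le> k \<and> (B \<union> {e}) - Z \<in> indep F))"

end

theory Submission imports Defs begin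

text \<open>Parallel extensions and restrictions are both instances of one construction: along a map
  \<open>f : T \<rightarrow> S\<close>, call \<open>X \<subseteq> T\<close> independent if \<open>f\<close> is injective on \<open>X\<close> and \<open>f ` X\<close> is independent.
  A parallel extension collapses \<open>s1\<close> and \<open>s2\<close> to \<open>s\<close>, a restriction is the case of the inclusion.
  Each of the five classes is closed under such pullbacks: an element parallel to a member of an
  independent set costs one circuit or one removed element, and \<open>k \<ge> 1\<close> pays for it.
  Contraction by \<open>I\<close> reduces to \<open>F\<close> by adding \<open>I\<close> to all sets involved; every circuit of the
  contraction is \<open>C - I\<close> for a circuit \<open>C\<close> of \<open>F\<close>.\<close>

section \<open>Pullbacks of set systems, and contraction membership\<close>

definition pullback :: "('b \<Rightarrow> 'a) \<Rightarrow> 'b set \<Rightarrow> 'a set_system \<Rightarrow> 'b set_system" where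
  "pullback f T F = (T, {X. X \<subseteq> T \<and> inj_on f X \<and> f ` X \<in> indep F})"

lemma ground_pullback [simp]: "ground (pullback f T F) = T"
  by (simp add: pullback_def)

lemma indep_pullback_iff:
  "X \<in> indep (pullback f T F) \<longleftrightarrow> X \<subseteq> T \<and> inj_on f X \<and> f ` X \<in> indep F"
  by (simp add: pullback_def)

lemma ground_contraction [simp]: "ground (contraction F I) = ground F - I"
  by (simp add: contraction_def)

lemma indep_contraction_iff:
  "X \<in> indep (contraction F I) \<longleftrightarrow> X \<subseteq> ground F - I \<and> X \<union> I \<in> indep F"
  by (simp add: contraction_def)

lemma restriction_eq_pullback: "restriction F Y = pullback id Y F"
  by (auto simp: restriction_def pullback_def)

text \<open>Elements of the new ground set other than \<open>s1\<close> and \<open>s2\<close> are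
  fixed by the map and differ from \<open>s\<close>, so \<open>s1\<close> and \<open>s2\<close> are
  the only pair with a common image. Hence containing at most one of them is the same as
  injectivity.\<close>

lemma parallel_extension_eq_pullback:
  assumes "s1 \<noteq> s2"
  shows "parallel_extension F s s1 s2 =
    pullback (\<lambda>x. if x \<in> {s1, s2} then s else x) ((ground F - {s}) \<union> {s1, s2}) F"
proof -
  let ?f = "\<lambda>x. if x \<in> {s1, s2} then s else x"
  let ?T = "(ground F - {s}) \<union> {s1, s2}"
  have img: "parallel_proj s s1 s2 X = ?f ` X" for X
    by (auto simp: parallel_proj_def image_def)
  have inj: "card (X \<inter> {s1, s2}) \<le> 1 \<longleftrightarrow> inj_on ?f X" if "X \<subseteq> ?T" for X
  proof -
    have "card (X \<inter> {s1, s2}) \<le> 1 \<longleftrightarrow> \<not> (s1 \<in> X \<and> s2 \<in> X)"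
      using assms by (cases "s1 \<in> X"; cases "s2 \<in> X") auto
    also have "\<dots> \<longleftrightarrow> inj_on ?f X"
    proof
      assume "\<not> (s1 \<in> X \<and> s2 \<in> X)"
      then show "inj_on ?f X" using that by (auto simp: inj_on_def)
    next
      assume "inj_on ?f X"
      then show "\<not> (s1 \<in> X \<and> s2 \<in> X)"
        using assms by (auto dest: inj_onD[where x = s1 and y = s2])
    qed
    finally show ?thesis .
  qed
  show ?thesis
    unfolding parallel_extension_def pullback_def Let_def img using inj by auto
qed

section \<open>Basic facts on independence systems, and their closure under the two
  constructions\<close>

lemma indep_finite: "independence_system F \<Longrightarrow> X \<in> indep F \<Longrightarrow> finite X"
  unfolding independence_system_def by (meson PowD finite_subset subsetD)

lemma indep_subset_ground: "independence_system F \<Longrightarrow> X \<in> indep F \<Longrightarrow> X \<subseteq> ground F"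
  unfolding independence_system_def by blast

lemma indep_mono: "independence_system F \<Longrightarrow> X \<in> indep F \<Longrightarrow> Y \<subseteq> X \<Longrightarrow> Y \<in> indep F"
  unfolding independence_system_def by blast

lemma empty_indep: "independence_system F \<Longrightarrow> {} \<in> indep F"
  unfolding independence_system_def by blast

text \<open>A dependent set is a circuit unless some proper subset is dependent; descending to such
  a subset terminates by finiteness.\<close>

lemma dependent_contains_circuit:
  assumes "finite X" "X \<subseteq> ground F" "X \<notin> indep F"
  obtains C where "circuit F C" "C \<subseteq> X"
proof -
  have "\<exists>C. circuit F C \<and> C \<subseteq> X"
    using assms
  proof (induction X rule: finite_psubset_induct)
    case (psubset X)
    show ?case
    proof (cases "\<forall>D. D \<subset> X \<longrightarrow> D \<in> indep F")
      case True
      then show ?thesis using psubset.prems unfolding circuit_def by blast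
    next
      case False
      then obtain D where "D \<subset> X" "D \<notin> indep F" by blast
      then show ?thesis using psubset.IH[of D] psubset.prems by blast
    qed
  qed
  then show thesis using that by blast
qed

lemma independence_system_pullback:
  assumes "independence_system F" "finite T"
  shows "independence_system (pullback f T F)"
  unfolding independence_system_def indep_pullback_iff ground_pullback
proof (intro conjI allI impI)
  have "{} \<in> indep (pullback f T F)"
    using empty_indep[OF assms(1)] by (simp add: indep_pullback_iff)
  then show "indep (pullback f T F) \<noteq> {}" by blast
  fix X Y assume XY: "(X \<subseteq> T \<and> inj_on f X \<and> f ` X \<in> indep F) \<and> Y \<subseteq> X"
  then show "Y \<subseteq> T" "inj_on f Y" by (auto intro: inj_on_subset)
  show "f ` Y \<in> indep F"
    using XY indep_mono[OF assms(1), of "f ` X" "f ` Y"] by blast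
qed (use assms in \<open>auto simp: indep_pullback_iff\<close>)

lemma independence_system_contraction:
  assumes F: "independence_system F" and I: "I \<in> indep F"
  shows "independence_system (contraction F I)"
  unfolding independence_system_def indep_contraction_iff ground_contraction
proof (intro conjI allI impI)
  show "finite (ground F - I)" using F unfolding independence_system_def by blast
  have "{} \<in> indep (contraction F I)" using I by (simp add: indep_contraction_iff)
  then show "indep (contraction F I) \<noteq> {}" by blast
  fix X Y assume XY: "(X \<subseteq> ground F - I \<and> X \<union> I \<in> indep F) \<and> Y \<subseteq> X"
  then show "Y \<subseteq> ground F - I" by blast
  show "Y \<union> I \<in> indep F"
    using XY indep_mono[OF F, of "X \<union> I" "Y \<union> I"] by blast
qed (auto simp: indep_contraction_iff)

section \<open>Matroid intersections and matchoids\<close>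

text \<open>Since \<open>f\<close> is injective on both sets, their images have the same sizes, and
  exchange in \<open>M\<close> gives some \<open>z\<close> in \<open>f\<close>
  Y\<open>outside\<close>f \<open>X\<close>. Any preimage of \<open>z\<close> in \<open>Y\<close>
  can be added to \<open>X\<close>: its image is new, so \<open>f\<close> stays injective.\<close>

lemma matroid_pullback:
  assumes M: "matroid M" and T: "finite T"
  shows "matroid (pullback f T M)"
  unfolding matroid_def
proof (intro conjI ballI impI)
  show "independence_system (pullback f T M)"
    using M T independence_system_pullback unfolding matroid_def by blast
  fix X Y
  assume X: "X \<in> indep (pullback f T M)" and Y: "Y \<in> indep (pullback f T M)"
    and less: "card X < card Y"
  have "card (f ` X) < card (f ` Y)"
    using X Y less by (simp add: indep_pullback_iff card_image)
  then obtain z where z: "z \<in> f ` Y - f ` X" "insert z (f ` X) \<in> indep M"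
    using M X Y unfolding matroid_def indep_pullback_iff by blast
  then obtain y where y: "y \<in> Y" "z = f y" by blast
  have "insert y X \<in> indep (pullback f T M)"
    using X Y y z unfolding indep_pullback_iff by (auto simp: inj_on_insert)
  moreover have "y \<in> Y - X" using y z by blast
  ultimately show "\<exists>y \<in> Y - X. insert y X \<in> indep (pullback f T M)" by blast
qed

text \<open>Both sets are disjoint from \<open>I\<close>, so adding \<open>I\<close> raises their
  sizes equally. The element exchanged in \<open>M\<close> lies outside \<open>X \<union> I\<close>,
  hence in \<open>Y - X\<close>.\<close>

lemma matroid_contraction:
  assumes M: "matroid M" and I: "I \<in> indep M"
  shows "matroid (contraction M I)"
  unfolding matroid_def
proof (intro conjI ballI impI)
  have ind: "independence_system M" using M unfolding matroid_def by blast
  then show "independence_system (contraction M I)"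
    using I by (rule independence_system_contraction)
  fix X Y
  assume "X \<in> indep (contraction M I)" and "Y \<in> indep (contraction M I)"
    and less: "card X < card Y"
  then have X: "X \<subseteq> ground M - I" "X \<union> I \<in> indep M"
    and Y: "Y \<subseteq> ground M - I" "Y \<union> I \<in> indep M"
    by (auto simp: indep_contraction_iff)
  have "finite (X \<union> I)" "finite (Y \<union> I)" using X Y indep_finite[OF ind] by blast+
  moreover have "X \<inter> I = {}" "Y \<inter> I = {}" using X Y by blast+
  ultimately have "card (X \<union> I) < card (Y \<union> I)"
    using less by (simp add: card_Un_disjoint)
  then obtain y where y: "y \<in> (Y \<union> I) - (X \<union> I)" "insert y (X \<union> I) \<in> indep M"
    using M X Y unfolding matroid_def by blast
  then have "insert y X \<in> indep (contraction M I)"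
    using X Y by (auto simp: indep_contraction_iff)
  then show "\<exists>y \<in> Y - X. insert y X \<in> indep (contraction M I)" using y by blast
qed

lemma k_matroid_intersection_pullback:
  assumes F: "k_matroid_intersection k F" and k: "k \<ge> 1" and T: "finite T"
  shows "k_matroid_intersection k (pullback f T F)"
proof -
  obtain \<I> where \<I>: "\<forall>i \<in> {1..k}. matroid (ground F, \<I> i)"
      and eq: "indep F = (\<Inter>i \<in> {1..k}. \<I> i)"
    using F unfolding k_matroid_intersection_def by blast
  \<comment> \<open>A nonempty index set lets the conditions \<open>X \<subseteq> T\<close> and
    \<open>inj_on f X\<close>, which do not mention \<open>i\<close>, be read off from one factor of
    the intersection.\<close>
  have one: "1 \<in> {1..k}" using k by simp
  let ?J = "\<lambda>i. indep (pullback f T (ground F, \<I> i))"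
  have "\<forall>i \<in> {1..k}. matroid (ground (pullback f T F), ?J i)"
  proof
    fix i assume that: "i \<in> {1..k}"
    have "(ground (pullback f T F), ?J i) = pullback f T (ground F, \<I> i)"
      by (simp add: pullback_def)
    then show "matroid (ground (pullback f T F), ?J i)"
      using matroid_pullback[of "(ground F, \<I> i)"] \<I> that T by metis
  qed
  moreover have "indep (pullback f T F) = (\<Inter>i \<in> {1..k}. ?J i)"
    using one unfolding set_eq_iff INT_iff indep_pullback_iff eq fst_conv snd_conv by blast
  moreover have "independence_system (pullback f T F)"
    using F T independence_system_pullback unfolding k_matroid_intersection_def by blast
  ultimately show ?thesis
    unfolding k_matroid_intersection_def by (intro conjI exI[of _ ?J])
qed

text \<open>The set \<open>I\<close> is independent in each of the matroids, so each may be
  contracted by \<open>I\<close> separately, and these contractions intersect in the contraction of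
  \<open>F\<close>.\<close>

lemma k_matroid_intersection_contraction:
  assumes F: "k_matroid_intersection k F" and k: "k \<ge> 1" and I: "I \<in> indep F"
  shows "k_matroid_intersection k (contraction F I)"
proof -
  obtain \<I> where \<I>: "\<forall>i \<in> {1..k}. matroid (ground F, \<I> i)"
      and eq: "indep F = (\<Inter>i \<in> {1..k}. \<I> i)"
    using F unfolding k_matroid_intersection_def by blast
  have one: "1 \<in> {1..k}" using k by simp
  let ?J = "\<lambda>i. indep (contraction (ground F, \<I> i) I)"
  have "\<forall>i \<in> {1..k}. matroid (ground (contraction F I), ?J i)"
  proof
    fix i assume that: "i \<in> {1..k}"
    have "(ground (contraction F I), ?J i) = contraction (ground F, \<I> i) I"
      by (simp add: contraction_def)
    moreover have "I \<in> \<I> i" using I eq that by blast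
    ultimately show "matroid (ground (contraction F I), ?J i)"
      using matroid_contraction[of "(ground F, \<I> i)" I] \<I> that by simp
  qed
  moreover have "indep (contraction F I) = (\<Inter>i \<in> {1..k}. ?J i)"
    using one unfolding set_eq_iff INT_iff indep_contraction_iff eq fst_conv snd_conv by blast
  moreover have "independence_system (contraction F I)"
    using F I independence_system_contraction unfolding k_matroid_intersection_def by blast
  ultimately show ?thesis
    unfolding k_matroid_intersection_def by (intro conjI exI[of _ ?J])
qed

text \<open>Independence enters as an equivalence for each single \<open>X\<close>, which allows a
  case distinction on whether \<open>X\<close> lies in the ground set.\<close>

lemma k_matchoidI:
  fixes N :: nat
  assumes "independence_system F"
    and "\<And>i. i \<in> {1..N} \<Longrightarrow> matroid (S i, \<I> i)"
    and "ground F = (\<Union>i \<in> {1..N}. S i)"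
    and "\<And>e. e \<in> ground F \<Longrightarrow> card {i \<in> {1..N}. e \<in> S i} \<le> k"
    and "\<And>X. X \<in> indep F \<longleftrightarrow> X \<subseteq> ground F \<and> (\<forall>i \<in> {1..N}. X \<inter> S i \<in> \<I> i)"
  shows "k_matchoid k F"
  unfolding k_matchoid_def
proof (intro conjI exI[of _ N] exI[of _ S] exI[of _ \<I>] ballI)
  show "indep F = {X. X \<subseteq> ground F \<and> (\<forall>i \<in> {1..N}. X \<inter> S i \<in> \<I> i)}"
    using assms(5) by (intro set_eqI) simp
qed (fact assms)+

text \<open>Each \<open>S i\<close> is replaced by its preimage in \<open>T\<close>. An element
  \<open>e\<close> then lies in exactly as many of the new ground sets as \<open>f e\<close> did of
  the old ones, so the bound \<open>k\<close> is kept even for parallel elements.\<close>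

lemma k_matchoid_pullback:
  assumes F: "k_matchoid k F" and T: "finite T" and fT: "f ` T \<subseteq> ground F"
  shows "k_matchoid k (pullback f T F)"
proof -
  obtain N :: nat and S \<I> where mat: "\<forall>i \<in> {1..N}. matroid (S i, \<I> i)"
    and gr: "ground F = (\<Union>i \<in> {1..N}. S i)"
    and deg: "\<forall>e \<in> ground F. card {i \<in> {1..N}. e \<in> S i} \<le> k"
    and eq: "indep F = {X. X \<subseteq> ground F \<and> (\<forall>i \<in> {1..N}. X \<inter> S i \<in> \<I> i)}"
    using F unfolding k_matchoid_def by blast
  let ?S = "\<lambda>i. {x \<in> T. f x \<in> S i}"
  let ?J = "\<lambda>i. indep (pullback f (?S i) (S i, \<I> i))"
  have "matroid (?S i, ?J i)" if "i \<in> {1..N}" for i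
  proof -
    have "(?S i, ?J i) = pullback f (?S i) (S i, \<I> i)" by (simp add: pullback_def)
    then show ?thesis using matroid_pullback[of "(S i, \<I> i)" "?S i" f] mat that T by simp
  qed
  moreover have "ground (pullback f T F) = (\<Union>i \<in> {1..N}. ?S i)"
    using fT gr by auto
  moreover have "card {i \<in> {1..N}. e \<in> ?S i} \<le> k" if "e \<in> T" for e
  proof -
    have "{i \<in> {1..N}. e \<in> ?S i} = {i \<in> {1..N}. f e \<in> S i}" using that by blast
    then show ?thesis using deg fT that by auto
  qed
  moreover have "X \<in> indep (pullback f T F) \<longleftrightarrow>
      X \<subseteq> T \<and> (\<forall>i \<in> {1..N}. X \<inter> ?S i \<in> ?J i)" for X
  proof (cases "X \<subseteq> T")
    case True
    then have img: "f ` (X \<inter> ?S i) = f ` X \<inter> S i" for i by blast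
    \<comment> \<open>two elements of a common fibre lie in a common \<open>?S i\<close>\<close>
    have inj: "inj_on f X \<longleftrightarrow> (\<forall>i \<in> {1..N}. inj_on f (X \<inter> ?S i))"
    proof
      assume *: "\<forall>i \<in> {1..N}. inj_on f (X \<inter> ?S i)"
      show "inj_on f X"
      proof (rule inj_onI)
        fix x y assume xy: "x \<in> X" "y \<in> X" "f x = f y"
        then obtain i where i: "i \<in> {1..N}" "f x \<in> S i" using True fT gr by blast
        then have "x \<in> X \<inter> ?S i" "y \<in> X \<inter> ?S i" using xy True by auto
        then show "x = y" using * i xy by (blast dest: inj_onD)
      qed
    qed (auto intro: inj_on_subset)
    have "f ` X \<subseteq> ground F" using True fT by blast
    then show ?thesis
      using True unfolding indep_pullback_iff img inj eq by auto
  next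
    case False
    then show ?thesis by (simp add: indep_pullback_iff)
  qed
  moreover have "independence_system (pullback f T F)"
    using F T independence_system_pullback unfolding k_matchoid_def by blast
  ultimately show ?thesis
    by (intro k_matchoidI[where N = N and S = ?S and \<I> = ?J]) (simp_all only: ground_pullback)
qed

text \<open>Contracting \<open>F\<close> by \<open>I\<close> amounts to contracting the
  \<open>i\<close>-th matroid by the part \<open>I \<inter> S i\<close>, which is independent
  there.\<close>

lemma k_matchoid_contraction:
  assumes F: "k_matchoid k F" and I: "I \<in> indep F"
  shows "k_matchoid k (contraction F I)"
proof -
  obtain N :: nat and S \<I> where mat: "\<forall>i \<in> {1..N}. matroid (S i, \<I> i)"
    and gr: "ground F = (\<Union>i \<in> {1..N}. S i)"
    and deg: "\<forall>e \<in> ground F. card {i \<in> {1..N}. e \<in> S i} \<le> k"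
    and eq: "indep F = {X. X \<subseteq> ground F \<and> (\<forall>i \<in> {1..N}. X \<inter> S i \<in> \<I> i)}"
    using F unfolding k_matchoid_def by blast
  let ?S = "\<lambda>i. S i - I"
  let ?J = "\<lambda>i. indep (contraction (S i, \<I> i) (I \<inter> S i))"
  have "matroid (?S i, ?J i)" if "i \<in> {1..N}" for i
  proof -
    have "(?S i, ?J i) = contraction (S i, \<I> i) (I \<inter> S i)"
      by (auto simp: contraction_def)
    moreover have "I \<inter> S i \<in> \<I> i" using I eq that by blast
    ultimately show ?thesis using matroid_contraction[of "(S i, \<I> i)" "I \<inter> S i"] mat that by simp
  qed
  moreover have "ground (contraction F I) = (\<Union>i \<in> {1..N}. ?S i)"
    using gr by auto
  moreover have "card {i \<in> {1..N}. e \<in> ?S i} \<le> k" if "e \<in> ground F - I" for e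
  proof -
    have "{i \<in> {1..N}. e \<in> ?S i} = {i \<in> {1..N}. e \<in> S i}" using that by blast
    then show ?thesis using deg that by auto
  qed
  moreover have "X \<in> indep (contraction F I) \<longleftrightarrow>
      X \<subseteq> ground F - I \<and> (\<forall>i \<in> {1..N}. X \<inter> ?S i \<in> ?J i)" for X
  proof (cases "X \<subseteq> ground F - I")
    case True
    then have un: "X \<inter> ?S i \<union> I \<inter> S i = (X \<union> I) \<inter> S i" for i by blast
    have "X \<union> I \<subseteq> ground F" using True I eq by blast
    then show ?thesis
      using True unfolding indep_contraction_iff eq fst_conv snd_conv un by blast
  next
    case False
    then show ?thesis by (simp add: indep_contraction_iff)
  qed
  moreover have "independence_system (contraction F I)"
    using F I independence_system_contraction unfolding k_matchoid_def by blast
  ultimately show ?thesis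
    by (intro k_matchoidI[where N = N and S = ?S and \<I> = ?J]) (simp_all only: ground_contraction)
qed

section \<open>Circuit bounded systems\<close>

text \<open>For subsets of a set on which \<open>f\<close> is injective, independence in the
  pullback is independence of the image in \<open>F\<close>, so minimal dependence carries
  over.\<close>

lemma circuit_image_pullback:
  assumes C: "circuit (pullback f T F) C" and inj: "inj_on f C" and fT: "f ` T \<subseteq> ground F"
  shows "circuit F (f ` C)"
  unfolding circuit_def
proof (intro conjI allI impI)
  have CT: "C \<subseteq> T" using C unfolding circuit_def by simp
  then show "f ` C \<subseteq> ground F" using fT by blast
  show "f ` C \<notin> indep F" using C CT inj unfolding circuit_def indep_pullback_iff by blast
  fix D assume D: "D \<subset> f ` C"
  then obtain E where E: "E \<subseteq> C" "D = f ` E" by (meson psubset_imp_subset subset_imageE)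
  then have "E \<subset> C" using D by blast
  then show "D \<in> indep F" using C E unfolding circuit_def indep_pullback_iff by blast
qed

lemma circuit_parallel_pair:
  assumes sys: "independence_system F"
    and J: "J \<in> indep (pullback f T F)" and x: "x \<in> J"
    and e: "e \<in> T - J" "f e = f x"
    and C: "circuit (pullback f T F) C" "C \<subseteq> J \<union> {e}"
  shows "C = {x, e}"
proof -
  have JT: "J \<subseteq> T" "inj_on f J" "f ` J \<in> indep F" using J by (auto simp: indep_pullback_iff)
  have down: "X \<in> indep (pullback f T F)" if "f ` X \<subseteq> f ` J" "inj_on f X" "X \<subseteq> T" for X
    using that JT indep_mono[OF sys] by (simp add: indep_pullback_iff)
  have ndep: "\<not> inj_on f C"
  proof
    assume "inj_on f C"
    moreover have "f ` C \<subseteq> f ` J" using C(2) e x by auto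
    moreover have "C \<subseteq> T" using C(2) JT(1) e by blast
    ultimately have "C \<in> indep (pullback f T F)" using down by simp
    then show False using C(1) unfolding circuit_def by simp
  qed
  then obtain a b where ab: "a \<in> C" "b \<in> C" "a \<noteq> b" "f a = f b"
    unfolding inj_on_def by blast
  have "x \<in> C \<and> e \<in> C"
  proof (cases "a = e \<or> b = e")
    case True
    \<comment> \<open>The partner of \<open>e\<close> lies in \<open>J\<close> and has the same
      image as \<open>x\<close>, so injectivity on \<open>J\<close> identifies the two.\<close>
    then obtain c where c: "c \<in> C" "c \<noteq> e" "f c = f x" using ab e(2) by metis
    then have "c = x" using C(2) JT(2) x by (auto dest: inj_onD)
    then show ?thesis using True ab c by blast
  next
    case False
    then show ?thesis using ab C(2) JT(2) by (auto dest: inj_onD)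
  qed
  then have "{x, e} \<subseteq> C" by blast
  moreover have "{x, e} \<notin> indep (pullback f T F)"
    using e x by (auto simp: indep_pullback_iff)
  ultimately show ?thesis using C(1) unfolding circuit_def by blast
qed

text \<open>Comparing cardinalities of two families of circuits requires the larger one to be
  finite.\<close>

lemma finite_circuits: "independence_system F \<Longrightarrow> finite {C. circuit F C \<and> P C}"
  by (rule finite_subset[of _ "Pow (ground F)"]) (auto simp: circuit_def independence_system_def)

lemma k_circuit_bounded_pullback:
  assumes F: "k_circuit_bounded k F" and k: "k \<ge> 1"
    and T: "finite T" and fT: "f ` T \<subseteq> ground F"
  shows "k_circuit_bounded k (pullback f T F)"
  unfolding k_circuit_bounded_def ground_pullback
proof (intro conjI ballI)
  have sys: "independence_system F" using F unfolding k_circuit_bounded_def by blast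
  show "independence_system (pullback f T F)"
    using sys T by (rule independence_system_pullback)
  fix J e assume J: "J \<in> indep (pullback f T F)" and e: "e \<in> T - J"
  let ?D = "{C. circuit (pullback f T F) C \<and> C \<subseteq> J \<union> {e}}"
  have JT: "J \<subseteq> T" "inj_on f J" "f ` J \<in> indep F" using J by (auto simp: indep_pullback_iff)
  show "card ?D \<le> k"
  proof (cases "f e \<in> f ` J")
    case True
    then obtain x where "x \<in> J" "f e = f x" by blast
    then have "?D \<subseteq> {{x, e}}" using circuit_parallel_pair[OF sys J _ e] by blast
    then have "card ?D \<le> card {{x, e}}" by (intro card_mono) auto
    then show ?thesis using k by simp
  next
    case False
    then have inj: "inj_on f (J \<union> {e})" using JT(2) by auto
    let ?E = "{C. circuit F C \<and> C \<subseteq> f ` J \<union> {f e}}"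
    have "(`) f ` ?D \<subseteq> ?E"
    proof
      fix D assume "D \<in> (`) f ` ?D"
      then obtain C where C: "D = f ` C" "circuit (pullback f T F) C" "C \<subseteq> J \<union> {e}" by blast
      then have "circuit F D" using circuit_image_pullback[OF C(2) _ fT] inj inj_on_subset by blast
      then show "D \<in> ?E" using C by blast
    qed
    moreover have "inj_on ((`) f) ?D"
      by (rule inj_on_subset[OF inj_on_image_Pow[OF inj]]) auto
    ultimately have "card ?D \<le> card ?E"
      using finite_circuits[OF sys] by (intro card_inj_on_le)
    also have "\<dots> \<le> k"
      using F JT(3) e fT False unfolding k_circuit_bounded_def by blast
    finally show ?thesis .
  qed
qed

text \<open>For a circuit \<open>D\<close> of the contraction, \<open>D \<union> I\<close> is
  dependent and contains a circuit \<open>C\<close> of \<open>F\<close>. Were \<open>C - I\<close>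
  independent in the contraction, \<open>C\<close> would be independent in \<open>F\<close>; so
  \<open>C - I\<close> is a dependent subset of \<open>D\<close> and equals \<open>D\<close>. Thus
  the circuits of \<open>F\<close> inside \<open>J \<union> I \<union> {e}\<close> cover those to be
  counted.\<close>

lemma k_circuit_bounded_contraction:
  assumes F: "k_circuit_bounded k F" and I: "I \<in> indep F"
  shows "k_circuit_bounded k (contraction F I)"
  unfolding k_circuit_bounded_def ground_contraction
proof (intro conjI ballI)
  have sys: "independence_system F" using F unfolding k_circuit_bounded_def by blast
  show "independence_system (contraction F I)"
    using sys I by (rule independence_system_contraction)
  fix J e assume J: "J \<in> indep (contraction F I)" and e: "e \<in> ground F - I - J"
  let ?D = "{C. circuit (contraction F I) C \<and> C \<subseteq> J \<union> {e}}"
  let ?E = "{C. circuit F C \<and> C \<subseteq> (J \<union> I) \<union> {e}}"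
  have "?D \<subseteq> (\<lambda>C. C - I) ` ?E"
  proof
    fix D assume "D \<in> ?D"
    then have D: "circuit (contraction F I) D" "D \<subseteq> J \<union> {e}" by auto
    then have DI: "D \<subseteq> ground F - I" "D \<union> I \<notin> indep F"
      unfolding circuit_def indep_contraction_iff by auto
    have gr: "D \<union> I \<subseteq> ground F" using DI indep_subset_ground[OF sys I] by blast
    have "finite (D \<union> I)"
      using finite_subset[OF gr] sys unfolding independence_system_def by blast
    then obtain C where C: "circuit F C" "C \<subseteq> D \<union> I"
      using dependent_contains_circuit[OF _ gr DI(2)] by blast
    have "C - I \<notin> indep (contraction F I)"
    proof
      assume "C - I \<in> indep (contraction F I)"
      then have "(C - I) \<union> I \<in> indep F" by (simp add: indep_contraction_iff)
      then have "C \<in> indep F" using indep_mono[OF sys] by blast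
      then show False using C unfolding circuit_def by blast
    qed
    moreover have "C - I \<subseteq> D" using C by blast
    ultimately have "D = C - I" using D unfolding circuit_def by blast
    then show "D \<in> (\<lambda>C. C - I) ` ?E" using C D by blast
  qed
  then have "card ?D \<le> card ?E" by (rule surj_card_le[OF finite_circuits[OF sys]])
  also have "\<dots> \<le> k"
    using F J e unfolding k_circuit_bounded_def indep_contraction_iff by blast
  finally show "card ?D \<le> k" .
qed

section \<open>Growth systems\<close>

lemma k_growthE:
  assumes "k_growth k F" "X \<subseteq> ground F" "I \<in> indep F"
  obtains Q Z where "Q \<union> Z = I - X" "Q \<inter> Z = {}" "card Z \<le> k * card (X - I)"
    "\<forall>P. basis_of F X P \<longrightarrow> P \<union> Q \<in> indep F"
proof -
  have "\<exists>Q Z. Q \<union> Z = I - X \<and> Q \<inter> Z = {} \<and> card Z \<le> k * card (X - I) \<and>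
      (\<forall>P. basis_of F X P \<longrightarrow> P \<union> Q \<in> indep F)"
    using assms unfolding k_growth_def by simp
  then show thesis by (elim exE conjE) (rule that)
qed

lemma basis_of_image_pullback:
  assumes P: "basis_of (pullback f T F) X P" and X: "X \<subseteq> T"
    and sys: "independence_system F"
  shows "basis_of F (f ` X) (f ` P)"
  unfolding basis_of_def
proof (intro conjI allI impI)
  have P': "P \<subseteq> X" "inj_on f P" "f ` P \<in> indep F"
    using P unfolding basis_of_def indep_pullback_iff by auto
  then show "f ` P \<subseteq> f ` X" "f ` P \<in> indep F" by auto
  fix R assume R: "f ` P \<subseteq> R \<and> R \<subseteq> f ` X \<and> R \<in> indep F"
  show "R = f ` P"
  proof (rule ccontr)
    assume "R \<noteq> f ` P"
    then obtain x where x: "x \<in> X" "f x \<in> R" "f x \<notin> f ` P" using R by blast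
    have "f ` insert x P \<subseteq> R" using x R by blast
    then have "f ` insert x P \<in> indep F" using R indep_mono[OF sys] by blast
    moreover have "inj_on f (insert x P)" using P'(2) x by auto
    ultimately have "insert x P \<in> indep (pullback f T F)"
      using x P'(1) X unfolding indep_pullback_iff by blast
    then have "insert x P = P" using P x P'(1) unfolding basis_of_def by blast
    then show False using x by blast
  qed
qed

text \<open>Growth in \<open>F\<close> for the images yields \<open>Q\<close> and \<open>Z\<close>,
  which are pulled back to \<open>J\<close>. Elements of \<open>J - X\<close> parallel to
  \<open>X\<close> are lost in the image difference and join the removed part; their partners in
  \<open>X - J\<close> account for them in the bound.\<close>

lemma k_growth_pullback:
  assumes F: "k_growth k F" and k: "k \<ge> 1" and T: "finite T" and fT: "f ` T \<subseteq> ground F"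
  shows "k_growth k (pullback f T F)"
  unfolding k_growth_def ground_pullback
proof (intro conjI allI impI)
  have sys: "independence_system F" using F unfolding k_growth_def by blast
  show "independence_system (pullback f T F)"
    using sys T by (rule independence_system_pullback)
  fix X J assume "X \<subseteq> T \<and> J \<in> indep (pullback f T F)"
  then have X: "X \<subseteq> T" and J: "J \<subseteq> T" "inj_on f J" "f ` J \<in> indep F"
    by (auto simp: indep_pullback_iff)
  have fin: "finite X" "finite J" using X J T finite_subset by blast+
  have gr: "f ` X \<subseteq> ground F" using X fT by blast
  obtain Q Z where QZ: "Q \<union> Z = f ` J - f ` X" "Q \<inter> Z = {}"
    and cardZ: "card Z \<le> k * card (f ` X - f ` J)"
    and bas: "\<forall>P. basis_of F (f ` X) P \<longrightarrow> P \<union> Q \<in> indep F"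
    by (rule k_growthE[OF F gr J(3)])
  \<comment> \<open>\<open>R\<close> consists of the elements of \<open>J - X\<close> that are parallel to an element of \<open>X\<close>, which
    then lies outside \<open>J\<close>\<close>
  let ?R = "{j \<in> J - X. f j \<in> f ` X}"
  let ?Q = "{j \<in> J. f j \<in> Q}"
  let ?Z = "?R \<union> {j \<in> J. f j \<in> Z}"
  show "\<exists>Q Z. Q \<union> Z = J - X \<and> Q \<inter> Z = {} \<and> card Z \<le> k * card (X - J) \<and>
      (\<forall>P. basis_of (pullback f T F) X P \<longrightarrow> P \<union> Q \<in> indep (pullback f T F))"
  proof (rule exI[of _ ?Q], rule exI[of _ ?Z], intro conjI allI impI)
    show "?Q \<union> ?Z = J - X"
    proof
      show "?Q \<union> ?Z \<subseteq> J - X" using QZ by auto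
      show "J - X \<subseteq> ?Q \<union> ?Z"
      proof
        fix j assume "j \<in> J - X"
        then show "j \<in> ?Q \<union> ?Z" using QZ by (cases "f j \<in> f ` X") auto
      qed
    qed
    show "?Q \<inter> ?Z = {}" using QZ by auto
    have "f ` {j \<in> J. f j \<in> Z} \<subseteq> Z" by blast
    moreover have "finite Z" using QZ fin by (metis finite_Diff finite_Un finite_imageI)
    moreover have "inj_on f {j \<in> J. f j \<in> Z}" using J(2) by (auto simp: inj_on_def)
    ultimately have "card {j \<in> J. f j \<in> Z} \<le> card Z" by (intro card_inj_on_le)
    then have Z_le: "card ?Z \<le> card ?R + card Z"
      using card_Un_le[of ?R "{j \<in> J. f j \<in> Z}"] by linarith
    have "f ` ?R \<subseteq> f ` (X - J)"
    proof
      fix y assume "y \<in> f ` ?R"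
      then obtain j x where j: "j \<in> J" "j \<notin> X" "y = f j" and x: "x \<in> X" "f j = f x" by auto
      then have "x \<notin> J" using J(2) by (auto dest: inj_onD)
      then show "y \<in> f ` (X - J)" using j x by auto
    qed
    \<comment> \<open>The two sets on the left are disjoint, since \<open>f\<close>
      ?R\<open>lies in\<close>f \<open>J\<close>. So \<open>X - J\<close> is large enough to pay for
      \<open>Z\<close> and for \<open>?R\<close> at once.\<close>
    then have "(f ` X - f ` J) \<union> f ` ?R \<subseteq> f ` (X - J)" by auto
    then have "card ((f ` X - f ` J) \<union> f ` ?R) \<le> card (X - J)"
      by (rule surj_card_le[rotated]) (use fin in simp)
    moreover have "card ((f ` X - f ` J) \<union> f ` ?R) = card (f ` X - f ` J) + card (f ` ?R)"
      using fin by (intro card_Un_disjoint) auto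
    moreover have "card (f ` ?R) = card ?R"
      using J(2) by (intro card_image) (auto simp: inj_on_def)
    ultimately have "card (f ` X - f ` J) + card ?R \<le> card (X - J)" by simp
    then have "k * card (f ` X - f ` J) + k * card ?R \<le> k * card (X - J)"
      by (metis distrib_left mult_le_mono2)
    moreover have "card ?R \<le> k * card ?R" using k by simp
    ultimately show "card ?Z \<le> k * card (X - J)" using Z_le cardZ by linarith
    fix P assume P: "basis_of (pullback f T F) X P"
    then have P': "P \<subseteq> X" "inj_on f P"
      unfolding basis_of_def indep_pullback_iff by auto
    have "f ` P \<union> Q \<in> indep F" using bas basis_of_image_pullback[OF P X sys] by blast
    moreover have "f ` (P \<union> ?Q) \<subseteq> f ` P \<union> Q" by auto
    ultimately have "f ` (P \<union> ?Q) \<in> indep F" using indep_mono[OF sys] by blast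
    moreover have "inj_on f (P \<union> ?Q)"
    proof -
      have "f ` P \<inter> Q = {}" using P'(1) QZ by blast
      moreover have "inj_on f ?Q" using J(2) by (auto simp: inj_on_def)
      ultimately show ?thesis using P'(2) by (auto simp: inj_on_Un)
    qed
    ultimately show "P \<union> ?Q \<in> indep (pullback f T F)"
      using P'(1) X J(1) unfolding indep_pullback_iff by blast
  qed
qed

text \<open>Removing \<open>I\<close> turns the independent sets of \<open>F\<close> between
  \<open>I\<close> and \<open>X \<union> I\<close> into the independent subsets of \<open>X\<close>
  in the contraction, and inclusion is preserved.\<close>

lemma basis_of_Un_contraction:
  assumes P: "basis_of (contraction F I) X P" and X: "X \<subseteq> ground F - I"
  shows "basis_of F (X \<union> I) (P \<union> I)"
  unfolding basis_of_def
proof (intro conjI allI impI)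
  have P': "P \<subseteq> X" "P \<union> I \<in> indep F"
    using P unfolding basis_of_def indep_contraction_iff by auto
  then show "P \<union> I \<subseteq> X \<union> I" "P \<union> I \<in> indep F" by auto
  fix R assume R: "P \<union> I \<subseteq> R \<and> R \<subseteq> X \<union> I \<and> R \<in> indep F"
  have RI: "(R - I) \<union> I = R" using R by blast
  have "R - I \<subseteq> X" using R by blast
  moreover have "R - I \<in> indep (contraction F I)"
    using R X RI by (auto simp: indep_contraction_iff)
  moreover have "P \<subseteq> R - I" using R P' X by blast
  ultimately have "R - I = P" using P unfolding basis_of_def by blast
  then show "R = P \<union> I" using RI by blast
qed

text \<open>Growth is applied to \<open>X \<union> I\<close> and \<open>J \<union> I\<close>. The
  set \<open>I\<close> cancels from both differences, so the same partition and the same bound serve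
  for \<open>X\<close> and \<open>J\<close>.\<close>

lemma k_growth_contraction:
  assumes F: "k_growth k F" and I: "I \<in> indep F"
  shows "k_growth k (contraction F I)"
  unfolding k_growth_def ground_contraction
proof (intro conjI allI impI)
  have sys: "independence_system F" using F unfolding k_growth_def by blast
  show "independence_system (contraction F I)"
    using sys I by (rule independence_system_contraction)
  fix X J assume "X \<subseteq> ground F - I \<and> J \<in> indep (contraction F I)"
  then have X: "X \<subseteq> ground F - I" and J: "J \<subseteq> ground F - I" "J \<union> I \<in> indep F"
    by (auto simp: indep_contraction_iff)
  have gr: "X \<union> I \<subseteq> ground F" using X indep_subset_ground[OF sys I] by blast
  obtain Q Z where QZ: "Q \<union> Z = (J \<union> I) - (X \<union> I)" "Q \<inter> Z = {}"
    and cardZ: "card Z \<le> k * card ((X \<union> I) - (J \<union> I))"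
    and bas: "\<forall>P. basis_of F (X \<union> I) P \<longrightarrow> P \<union> Q \<in> indep F"
    by (rule k_growthE[OF F gr J(2)])
  have "(J \<union> I) - (X \<union> I) = J - X" "(X \<union> I) - (J \<union> I) = X - J" using X J by blast+
  moreover have "P \<union> Q \<in> indep (contraction F I)" if P: "basis_of (contraction F I) X P" for P
  proof -
    have "P \<union> I \<union> Q \<in> indep F" using bas basis_of_Un_contraction[OF P X] by blast
    then have "P \<union> Q \<union> I \<in> indep F" by (simp add: Un_ac)
    moreover have "P \<subseteq> X" using P unfolding basis_of_def by blast
    ultimately show ?thesis using QZ X J unfolding indep_contraction_iff by blast
  qed
  ultimately show "\<exists>Q Z. Q \<union> Z = J - X \<and> Q \<inter> Z = {} \<and> card Z \<le> k * card (X - J) \<and>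
      (\<forall>P. basis_of (contraction F I) X P \<longrightarrow> P \<union> Q \<in> indep (contraction F I))"
    using QZ cardZ by - (rule exI[of _ Q], rule exI[of _ Z], simp)
qed

section \<open>Extendible systems\<close>

lemma k_extendibleE:
  assumes "k_extendible k F" "A \<subseteq> B" "B \<in> indep F" "e \<in> ground F - B" "A \<union> {e} \<in> indep F"
  obtains Z where "Z \<subseteq> B - A" "card Z \<le> k" "(B \<union> {e}) - Z \<in> indep F"
proof -
  have "\<exists>Z. Z \<subseteq> B - A \<and> card Z \<le> k \<and> (B \<union> {e}) - Z \<in> indep F"
    using assms unfolding k_extendible_def by simp
  then show thesis by (elim exE conjE) (rule that)
qed

lemma k_extendible_pullback:
  assumes F: "k_extendible k F" and k: "k \<ge> 1" and T: "finite T" and fT: "f ` T \<subseteq> ground F"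
  shows "k_extendible k (pullback f T F)"
  unfolding k_extendible_def ground_pullback
proof (intro conjI allI impI)
  have sys: "independence_system F" using F unfolding k_extendible_def by blast
  show "independence_system (pullback f T F)"
    using sys T by (rule independence_system_pullback)
  fix A B e
  assume asm: "A \<subseteq> B \<and> B \<in> indep (pullback f T F) \<and> e \<in> T - B \<and>
    A \<union> {e} \<in> indep (pullback f T F)"
  then have AB: "A \<subseteq> B" and B: "B \<subseteq> T" "inj_on f B" "f ` B \<in> indep F" and e: "e \<in> T" "e \<notin> B"
    and Ae: "inj_on f (A \<union> {e})" "f ` A \<union> {f e} \<in> indep F"
    by (auto simp: indep_pullback_iff)
  show "\<exists>Z. Z \<subseteq> B - A \<and> card Z \<le> k \<and> (B \<union> {e}) - Z \<in> indep (pullback f T F)"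
  proof (cases "f e \<in> f ` B")
    case True
    then obtain b where b: "b \<in> B" "f e = f b" by blast
    \<comment> \<open>Independence of \<open>A \<union> {e}\<close> in the pullback excludes
      elements of \<open>A\<close> parallel to \<open>e\<close>.\<close>
    have "b \<notin> A" using Ae(1) b e by (auto simp: inj_on_def)
    moreover have "f ` ((B \<union> {e}) - {b}) \<subseteq> f ` B" using b by auto
    then have "f ` ((B \<union> {e}) - {b}) \<in> indep F" using B(3) indep_mono[OF sys] by blast
    moreover have "inj_on f ((B \<union> {e}) - {b})" using B(2) b e by (auto simp: inj_on_def)
    ultimately show ?thesis
      using b k e B(1) by (intro exI[of _ "{b}"]) (auto simp: indep_pullback_iff)
  next
    case False
    have "f ` A \<subseteq> f ` B" "f e \<in> ground F - f ` B" using AB e fT False by auto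
    then obtain Z where Z: "Z \<subseteq> f ` B - f ` A" "card Z \<le> k" "(f ` B \<union> {f e}) - Z \<in> indep F"
      using k_extendibleE[OF F _ B(3) _ Ae(2)] by metis
    let ?Z = "{b \<in> B. f b \<in> Z}"
    have "finite Z" using Z(1) B(3) indep_finite[OF sys] finite_subset by blast
    moreover have "f ` ?Z \<subseteq> Z" "inj_on f ?Z" using B(2) by (auto simp: inj_on_def)
    ultimately have "card ?Z \<le> k" using Z(2) by (meson card_inj_on_le order_trans)
    moreover have "?Z \<subseteq> B - A" using Z(1) by auto
    moreover have "f ` ((B \<union> {e}) - ?Z) \<subseteq> (f ` B \<union> {f e}) - Z"
      using Z(1) False by auto
    then have "f ` ((B \<union> {e}) - ?Z) \<in> indep F" using Z(3) indep_mono[OF sys] by blast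
    moreover have "inj_on f (B \<union> {e})" using B(2) False by auto
    then have "inj_on f ((B \<union> {e}) - ?Z)" by (rule inj_on_subset) blast
    moreover have "(B \<union> {e}) - ?Z \<subseteq> T" using B(1) e by blast
    ultimately show ?thesis
      unfolding indep_pullback_iff by (intro exI[of _ ?Z] conjI)
  qed
qed

text \<open>Extendibility is applied to \<open>A \<union> I\<close> and \<open>B \<union> I\<close>.
  The removed set avoids \<open>A \<union> I\<close>, so \<open>I\<close> stays whole and the result
  is again independent in the contraction.\<close>

lemma k_extendible_contraction:
  assumes F: "k_extendible k F" and I: "I \<in> indep F"
  shows "k_extendible k (contraction F I)"
  unfolding k_extendible_def ground_contraction
proof (intro conjI allI impI)
  have sys: "independence_system F" using F unfolding k_extendible_def by blast
  show "independence_system (contraction F I)"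
    using sys I by (rule independence_system_contraction)
  fix A B e
  assume asm: "A \<subseteq> B \<and> B \<in> indep (contraction F I) \<and> e \<in> ground F - I - B \<and>
    A \<union> {e} \<in> indep (contraction F I)"
  have "(A \<union> I) \<union> {e} = A \<union> {e} \<union> I" by blast
  then have "A \<union> I \<subseteq> B \<union> I" "B \<union> I \<in> indep F" "e \<in> ground F - (B \<union> I)"
    "(A \<union> I) \<union> {e} \<in> indep F"
    using asm unfolding indep_contraction_iff by auto
  then obtain Z where Z: "Z \<subseteq> (B \<union> I) - (A \<union> I)" "card Z \<le> k"
      "((B \<union> I) \<union> {e}) - Z \<in> indep F"
    by (rule k_extendibleE[OF F])
  have "((B \<union> I) \<union> {e}) - Z = ((B \<union> {e}) - Z) \<union> I" using Z(1) by blast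
  then show "\<exists>Z. Z \<subseteq> B - A \<and> card Z \<le> k \<and> (B \<union> {e}) - Z \<in> indep (contraction F I)"
    using Z asm by (intro exI[of _ Z]) (auto simp: indep_contraction_iff)
qed

section \<open>Closure of all five classes\<close>

theorem lemma9:
  fixes k :: nat
    and \<C> :: "'a set_system \<Rightarrow> bool"
    and F :: "'a set_system"
  assumes "k \<ge> 1"
    and "\<C> \<in> {k_matroid_intersection k, k_matchoid k, k_circuit_bounded k, k_growth k, k_extendible k}"
    and "\<C> F"
  shows "(\<forall>s s1 s2. s \<in> ground F \<and> \<not> loop F s \<and> s1 \<notin> ground F \<and> s2 \<notin> ground F \<and> s1 \<noteq> s2 \<longrightarrow>
            \<C> (parallel_extension F s s1 s2)) \<and>
         (\<forall>Y. Y \<subseteq> ground F \<longrightarrow> \<C> (restriction F Y)) \<and>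
         (\<forall>I \<in> indep F. \<C> (contraction F I))"
proof -
  have "independence_system F"
    using assms(2,3) by (auto simp: k_matroid_intersection_def k_matchoid_def
      k_circuit_bounded_def k_growth_def k_extendible_def)
  then have fin: "finite (ground F)" unfolding independence_system_def by blast
  have pullback: "\<C> (pullback f T F)" if "finite T" "f ` T \<subseteq> ground F" for f T
    using assms that
    by (auto intro: k_matroid_intersection_pullback k_matchoid_pullback
      k_circuit_bounded_pullback k_growth_pullback k_extendible_pullback)
  have contraction: "\<C> (contraction F I)" if "I \<in> indep F" for I
    using assms that
    by (auto intro: k_matroid_intersection_contraction k_matchoid_contraction
      k_circuit_bounded_contraction k_growth_contraction k_extendible_contraction)
  have "\<C> (restriction F Y)" if "Y \<subseteq> ground F" for Y
    unfolding restriction_eq_pullback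
    using that finite_subset[OF that fin] by (intro pullback) auto
  moreover have "\<C> (parallel_extension F s s1 s2)" if "s \<in> ground F" "s1 \<noteq> s2" for s s1 s2
    unfolding parallel_extension_eq_pullback[OF that(2)]
    \<comment> \<open>The collapsing map lands in \<open>ground F\<close> because \<open>s\<close>
      does.\<close>
    using that fin by (intro pullback) auto
  ultimately show ?thesis using contraction by blast
qed

end
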